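(* Let $\gamma_1,\gamma_2,\beta_1,\beta_2,\beta_3$ be real constants with $\gamma_1\neq 0$, $\beta_1,\beta_2,\beta_3>0$ and $\gamma_2\neq 0$. Then the control system with states $(x,y,\theta,u,v,r)\in\mathbb{R}^6$ and inputs $(u_1,u_2)\in\mathbb{R}^2$ given by $$\dot x=u\cos\theta-v\sin\theta,\quad \dot y=u\sin\theta+v\cos\theta,\quad \dot\theta=r,$$ $$\dot u=\tfrac{1}{\gamma_1}vr-\beta_1u+u_1,\quad \dot v=-\gamma_1ur-\beta_2v,\quad \dot r=\gamma_2uv-\beta_3r+u_2$$ is dynamic feedback linearizable, with a dynamic extension of order $6$.
   Context: All notions are local: they are understood on some nonempty open set of the relevant coordinate space. A control system $\dot x=f(t,x,u)$, $x\in\mathbb{R}^n$, $u\in\mathbb{R}^m$, is *static feedback linearizable* if there is a local change of state and input coordinates $(t,x,u)\mapsto(t,\bar x(t,x),\bar u(t,x,u))$, a local diffeomorphism, transforming it into a Brunovsky normal form, i.e. a collection of $m$ decoupled chains of integrators $\dot z_0=z_1,\ \dot z_1=z_2,\dots,\dot z_{j-1}=z_j$, where $z_0,\dots,z_{j-1}$ are states and $z_j$ is an input; such a chain is said to have order $j$. A *dynamic extension* of $\dot x=f(t,x,u)$ is a system of the form $\dot x=f(t,x,b(t,x,\zeta,\nu))$, $\dot\zeta=a(t,x,\zeta,\nu)$, with states $(x,\zeta)$ and inputs $\nu\in\mathbb{R}^m$, where $a,b$ are smooth and the map $(t,x,\zeta,\nu)\mapsto(t,x,b(t,x,\zeta,\nu))$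 is a submersion. (For example, one may first apply an invertible static feedback transformation and then differentiate some of the new inputs finitely many times.) The control system is *dynamic feedback linearizable* if it has a static feedback linearizable dynamic extension. The *order* of such a static feedback linearizable dynamic extension is the largest order of a chain in its Brunovsky normal form. *)

theory Defs
  imports "HOL-Analysis.Analysis"
begin

(* Dimensions such as the number of states of an extension are quantified inside formulas, so
   R^N is the carrier of the library's Euclidean_space N: the functions nat => real that vanish
   at all indices \<ge> N. *)

type_synonym vec = "nat \<Rightarrow> real"

(* The right-hand side f(t, x, u) of a control system; only its components below the number of
   states are meaningful. *)
type_synonym system = "real \<Rightarrow> vec \<Rightarrow> vec \<Rightarrow> vec"


definition slice :: "nat \<Rightarrow> nat \<Rightarrow> vec \<Rightarrow> vec" where
  "slice d n p = (\<lambda>i. if i < n then p (d + i) else 0)"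

definition join :: "nat \<Rightarrow> nat \<Rightarrow> vec \<Rightarrow> vec \<Rightarrow> vec" where
  "join n m x y = (\<lambda>i. if i < n then x i else if i < n + m then y (i - n) else 0)"

(* (t, x, u) as a point of R^(1+n+m), and the projections back. *)

definition pt :: "nat \<Rightarrow> nat \<Rightarrow> real \<Rightarrow> vec \<Rightarrow> vec \<Rightarrow> vec" where
  "pt n m t x u = join 1 (n + m) (\<lambda>_. t) (join n m x u)"

definition time_of :: "vec \<Rightarrow> real" where
  "time_of p = p 0"

definition state_of :: "nat \<Rightarrow> vec \<Rightarrow> vec" where
  "state_of n p = slice 1 n p"

definition input_of :: "nat \<Rightarrow> nat \<Rightarrow> vec \<Rightarrow> vec" where
  "input_of n m p = slice (1 + n) m p"


definition pderivative :: "nat \<Rightarrow> (vec \<Rightarrow> real) \<Rightarrow> vec \<Rightarrow> real" where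
  "pderivative i F p = deriv (\<lambda>s. F (p(i := s))) (p i)"

primrec C_k_on :: "nat \<Rightarrow> nat \<Rightarrow> vec set \<Rightarrow> (vec \<Rightarrow> real) \<Rightarrow> bool" where
  "C_k_on 0 N U F \<longleftrightarrow> continuous_map (subtopology (Euclidean_space N) U) euclideanreal F"
| "C_k_on (Suc k) N U F \<longleftrightarrow>
     continuous_map (subtopology (Euclidean_space N) U) euclideanreal F \<and>
     (\<forall>i<N. (\<forall>p\<in>U. (\<lambda>s. F (p(i := s))) differentiable (at (p i))) \<and>
            C_k_on k N U (pderivative i F))"

(* Used for U open in R^N only. *)
definition smooth_fun_on :: "nat \<Rightarrow> vec set \<Rightarrow> (vec \<Rightarrow> real) \<Rightarrow> bool" where
  "smooth_fun_on N U F \<longleftrightarrow> (\<forall>k. C_k_on k N U F)"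

definition smooth_map_on :: "nat \<Rightarrow> nat \<Rightarrow> vec set \<Rightarrow> (vec \<Rightarrow> vec) \<Rightarrow> bool" where
  "smooth_map_on N M U F \<longleftrightarrow>
     F ` U \<subseteq> topspace (Euclidean_space M) \<and> (\<forall>i<M. smooth_fun_on N U (\<lambda>p. F p i))"

definition diffeomorphism_on :: "nat \<Rightarrow> vec set \<Rightarrow> (vec \<Rightarrow> vec) \<Rightarrow> bool" where
  "diffeomorphism_on N U \<Phi> \<longleftrightarrow>
     openin (Euclidean_space N) U \<and> openin (Euclidean_space N) (\<Phi> ` U) \<and>
     smooth_map_on N N U \<Phi> \<and>
     (\<exists>\<Psi>. smooth_map_on N N (\<Phi> ` U) \<Psi> \<and> (\<forall>p\<in>U. \<Psi> (\<Phi> p) = p))"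

(* Surjectivity of the differential, i.e. of the linear map given by the Jacobian matrix. *)
definition submersion_on :: "nat \<Rightarrow> nat \<Rightarrow> vec set \<Rightarrow> (vec \<Rightarrow> vec) \<Rightarrow> bool" where
  "submersion_on N M U G \<longleftrightarrow>
     openin (Euclidean_space N) U \<and> smooth_map_on N M U G \<and>
     (\<forall>p\<in>U. \<forall>w\<in>topspace (Euclidean_space M). \<exists>h\<in>topspace (Euclidean_space N).
        \<forall>i<M. (\<Sum>j<N. pderivative j (\<lambda>q. G q i) p * h j) = w i)"


(* A smooth system with n states and m inputs on a nonempty open set D of (t, x, u)-space. *)
definition control_system :: "nat \<Rightarrow> nat \<Rightarrow> vec set \<Rightarrow> system \<Rightarrow> bool" where
  "control_system n m D f \<longleftrightarrow>
     openin (Euclidean_space (1 + n + m)) D \<and> D \<noteq> {} \<and>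
     (\<forall>i<n. smooth_fun_on (1 + n + m) D
        (\<lambda>p. f (time_of p) (state_of n p) (input_of n m p) i))"

(* Derivative of y(t, x) along the system: the t-derivative plus f times the x-gradient. *)
definition total_derivative ::
    "nat \<Rightarrow> system \<Rightarrow> (real \<Rightarrow> vec \<Rightarrow> real) \<Rightarrow> real \<Rightarrow> vec \<Rightarrow> vec \<Rightarrow> real" where
  "total_derivative n f y t x u =
     deriv (\<lambda>s. y s x) t + (\<Sum>j<n. deriv (\<lambda>s. y t (x(j := s))) (x j) * f t x u j)"

(* (t, x, u) \<mapsto> (t, X(t, x), W(t, x, u)) is a diffeomorphism from U onto its image that carries
   dx/dt = f(t, x, u) to dz/dt = g(t, z, w). *)
definition static_feedback_transformation ::
    "nat \<Rightarrow> nat \<Rightarrow> vec set \<Rightarrow> system \<Rightarrow> system \<Rightarrow>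
     (real \<Rightarrow> vec \<Rightarrow> vec) \<Rightarrow> (real \<Rightarrow> vec \<Rightarrow> vec \<Rightarrow> vec) \<Rightarrow> bool" where
  "static_feedback_transformation n m U f g X W \<longleftrightarrow>
     diffeomorphism_on (1 + n + m) U
       (\<lambda>p. let t = time_of p; x = state_of n p; u = input_of n m p
             in pt n m t (X t x) (W t x u)) \<and>
     (\<forall>p\<in>U. let t = time_of p; x = state_of n p; u = input_of n m p in
        \<forall>i<n. total_derivative n f (\<lambda>s q. X s q i) t x u
                = g t (slice 0 n (X t x)) (slice 0 m (W t x u)) i)"

(* One chain for each entry of js, the entry being the order of the chain. The states are numbered
   chain by chain, so position l of chain c is the state with index
   sum_list (take c js) + l; the input of chain c is w c. *)
definition brunovsky_form :: "nat \<Rightarrow> nat \<Rightarrow> nat list \<Rightarrow> system \<Rightarrow> bool" where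
  "brunovsky_form n m js g \<longleftrightarrow>
     length js = m \<and> sum_list js = n \<and> (\<forall>j\<in>set js. 1 \<le> j) \<and>
     (\<forall>t z w. \<forall>c<m. \<forall>l<js ! c.
        g t z w (sum_list (take c js) + l) =
          (if Suc l < js ! c then z (sum_list (take c js) + Suc l) else w c))"

definition linearizes_to :: "nat \<Rightarrow> nat \<Rightarrow> vec set \<Rightarrow> system \<Rightarrow> nat list \<Rightarrow> bool" where
  "linearizes_to n m D f js \<longleftrightarrow>
     control_system n m D f \<and>
     (\<exists>U g X W. U \<subseteq> D \<and> U \<noteq> {} \<and> brunovsky_form n m js g \<and>
        static_feedback_transformation n m U f g X W)"

definition static_feedback_linearizable :: "nat \<Rightarrow> nat \<Rightarrow> vec set \<Rightarrow> system \<Rightarrow> bool" where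
  "static_feedback_linearizable n m D f \<longleftrightarrow> (\<exists>js. linearizes_to n m D f js)"

definition linearizable_of_order :: "nat \<Rightarrow> nat \<Rightarrow> vec set \<Rightarrow> system \<Rightarrow> nat \<Rightarrow> bool" where
  "linearizable_of_order n m D f r \<longleftrightarrow> (\<exists>js. linearizes_to n m D f js \<and> Max (set js) = r)"


(* The right-hand side (f(t, x, b(t, x, \<zeta>, \<nu>)), a(t, x, \<zeta>, \<nu>)) on states (x, \<zeta>) with k
   components \<zeta>. *)
definition extended_system ::
    "nat \<Rightarrow> nat \<Rightarrow> system \<Rightarrow> nat \<Rightarrow> (real \<Rightarrow> vec \<Rightarrow> vec \<Rightarrow> vec \<Rightarrow> vec) \<Rightarrow>
     (real \<Rightarrow> vec \<Rightarrow> vec \<Rightarrow> vec \<Rightarrow> vec) \<Rightarrow> system" where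
  "extended_system n m f k a b =
     (\<lambda>t q \<nu>. let x = slice 0 n q; \<zeta> = slice n k q
              in join n k (f t x (slice 0 m (b t x \<zeta> \<nu>))) (a t x \<zeta> \<nu>))"

(* a and b are given on a nonempty open set V of (t, x, \<zeta>, \<nu>)-space. Smoothness of b is part of
   the submersion condition. *)
definition dynamic_extension ::
    "nat \<Rightarrow> nat \<Rightarrow> vec set \<Rightarrow> system \<Rightarrow> nat \<Rightarrow> vec set \<Rightarrow>
     (real \<Rightarrow> vec \<Rightarrow> vec \<Rightarrow> vec \<Rightarrow> vec) \<Rightarrow> (real \<Rightarrow> vec \<Rightarrow> vec \<Rightarrow> vec \<Rightarrow> vec) \<Rightarrow> bool" where
  "dynamic_extension n m D f k V a b \<longleftrightarrow>
     openin (Euclidean_space (1 + (n + k) + m)) V \<and> V \<noteq> {} \<and>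
     (let tm = time_of; xs = (\<lambda>p. slice 0 n (state_of (n + k) p));
          zs = (\<lambda>p. slice n k (state_of (n + k) p)); ns = input_of (n + k) m;
          G = (\<lambda>p. pt n m (tm p) (xs p) (b (tm p) (xs p) (zs p) (ns p)))
      in G ` V \<subseteq> D \<and>
         (\<forall>i<k. smooth_fun_on (1 + (n + k) + m) V
            (\<lambda>p. a (tm p) (xs p) (zs p) (ns p) i)) \<and>
         submersion_on (1 + (n + k) + m) (1 + n + m) V G)"

definition dynamic_feedback_linearizable :: "nat \<Rightarrow> nat \<Rightarrow> vec set \<Rightarrow> system \<Rightarrow> bool" where
  "dynamic_feedback_linearizable n m D f \<longleftrightarrow>
     control_system n m D f \<and>
     (\<exists>k V a b. dynamic_extension n m D f k V a b \<and>
        static_feedback_linearizable (n + k) m V (extended_system n m f k a b))"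


(* States (x, y, \<theta>, u, v, r) are q 0, ..., q 5; the inputs (u_1, u_2) are w 0, w 1. *)
definition vessel :: "real \<Rightarrow> real \<Rightarrow> real \<Rightarrow> real \<Rightarrow> real \<Rightarrow> system" where
  "vessel \<gamma>1 \<gamma>2 \<beta>1 \<beta>2 \<beta>3 = (\<lambda>t q w.
     let \<theta> = q 2; u = q 3; v = q 4; r = q 5 in
     (\<lambda>_. 0)(0 := u * cos \<theta> - v * sin \<theta>,
             1 := u * sin \<theta> + v * cos \<theta>,
             2 := r,
             3 := (1 / \<gamma>1) * v * r - \<beta>1 * u + w 0,
             4 := - \<gamma>1 * u * r - \<beta>2 * v,
             5 := \<gamma>2 * u * v - \<beta>3 * r + w 1))"

end

(* Given the heading, the equations are linear time-varying with the single input u, the surge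
   speed. In the rotating frame xi + i eta = (x + i y) exp(-i theta) and with w = v + gamma1 r xi,
   the input enters only the xi equation:
     xi' = u + r eta,  eta' = w - (1 + gamma1) r xi,
     w' = -beta2 w + gamma1 (r' + beta2 r) xi + gamma1 r^2 eta.
   So xi cancels from the derivative of F = gamma1 (r' + beta2 r) eta + (1 + gamma1) r w: F and F'
   involve only eta and w, the second derivative brings in xi and the third brings in u. The
   coefficients of xi in the second and of u in the third are the same delta(r, r', r"), which is
   also the determinant of (F, F') in (eta, w). Where delta does not vanish (for instance at r = 1,
   r' = r" = 0), (theta, F) is a flat output. Prolonging u_2 so that theta^(6) is an input and
   keeping u' as the other one gives chains of orders 6 and 4. *)

theory Submission
  imports Defs
begin

subsection \<open>Smooth functions on open subsets of Euclidean space\<close>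

text \<open>\<open>U\<close> lies in the carrier, so the nested subspace topologies collapse to that
  of \<open>U\<close> in the product topology on functions, where the \<open>continuous_on\<close>
  rules apply.\<close>

lemma continuous_map_Euclidean_subspace_iff:
  assumes "openin (Euclidean_space N) U"
  shows "continuous_map (subtopology (Euclidean_space N) U) euclideanreal F \<longleftrightarrow> continuous_on U F"
proof -
  have "{x. \<forall>i\<ge>N. x i = 0} \<inter> U = U"
    using openin_subset[OF assms] by (auto simp: topspace_Euclidean_space)
  then show ?thesis
    by (simp add: Euclidean_space_def subtopology_subtopology euclidean_product_topology)
qed

text \<open>Changing a coordinate below \<open>N\<close> keeps a point in the carrier and is
  continuous in the new value. Hence partial derivatives at points of \<open>U\<close> depend on
  values in \<open>U\<close> alone.\<close>

lemma eventually_fun_upd_in_open: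
  assumes "openin (Euclidean_space N) U" "p \<in> U" "i < N"
  shows "\<forall>\<^sub>F s in nhds (p i). p(i := s) \<in> U"
proof -
  have p: "p \<in> topspace (Euclidean_space N)"
    using openin_subset assms by blast
  have "continuous_on UNIV (\<lambda>s. p(i := s))"
  proof (rule continuous_on_coordinatewise_then_product)
    show "continuous_on UNIV (\<lambda>s. (p(i := s)) j)" for j
      by (cases "j = i") (auto intro: continuous_intros)
  qed
  then have "continuous_map euclideanreal (powertop_real UNIV) (\<lambda>s. p(i := s))"
    by (simp add: euclidean_product_topology)
  then have "continuous_map euclideanreal (Euclidean_space N) (\<lambda>s. p(i := s))"
    using p \<open>i < N\<close>
    by (auto simp: Euclidean_space_def continuous_map_in_subtopology topspace_Euclidean_space)
  from openin_continuous_map_preimage[OF this assms(1)]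
  have "open {s. p(i := s) \<in> U}" by simp
  moreover have "p(i := p i) \<in> U" using \<open>p \<in> U\<close> by simp
  ultimately show ?thesis
    using eventually_nhds_in_open[of "{s. p(i := s) \<in> U}" "p i"] by simp
qed

lemma openin_Euclidean_nonzero:
  assumes "continuous_on (topspace (Euclidean_space N)) F"
  shows "openin (Euclidean_space N) {p \<in> topspace (Euclidean_space N). (F p :: real) \<noteq> 0}"
proof -
  have "continuous_map (Euclidean_space N) euclideanreal F"
    using assms continuous_map_Euclidean_subspace_iff[OF openin_topspace]
    by (simp add: subtopology_topspace)
  from openin_continuous_map_preimage[OF this, of "- {0}"]
  show ?thesis by (simp add: open_Compl)
qed

section \<open>Closure properties of C^k and smooth functions\<close>

context
  fixes N :: nat and U :: "vec set"
  assumes U: "openin (Euclidean_space N) U"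
begin

lemma C_k_on_Suc:
  "C_k_on (Suc k) N U F \<longleftrightarrow> continuous_on U F \<and>
     (\<forall>i<N. (\<forall>p\<in>U. (\<lambda>s. F (p(i := s))) differentiable (at (p i))) \<and> C_k_on k N U (pderivative i F))"
  by (simp add: continuous_map_Euclidean_subspace_iff[OF U])

text \<open>Agreement is known on \<open>U\<close> only; openness makes the partial derivatives
  agree there as well, and the induction continues with these.\<close>

lemma C_k_on_cong:
  assumes "\<And>p. p \<in> U \<Longrightarrow> F p = G p"
  shows "C_k_on k N U F \<longleftrightarrow> C_k_on k N U G"
  using assms
proof (induction k arbitrary: F G)
  case 0
  then show ?case
    by (simp add: continuous_map_Euclidean_subspace_iff[OF U] cong: continuous_on_cong)
next
  case (Suc k)
  have ev: "\<forall>\<^sub>F s in nhds (p i). F (p(i := s)) = G (p(i := s))" if "p \<in> U" "i < N" for p i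
    using eventually_fun_upd_in_open[OF U that] by eventually_elim (rule Suc.prems)
  have "pderivative i F p = pderivative i G p" if "p \<in> U" "i < N" for p i
    unfolding pderivative_def using ev[OF that] by (intro deriv_cong_ev) auto
  moreover have "(\<lambda>s. F (p(i := s))) differentiable (at (p i))
      \<longleftrightarrow> (\<lambda>s. G (p(i := s))) differentiable (at (p i))" if "p \<in> U" "i < N" for p i
    unfolding real_differentiable_def
    using DERIV_cong_ev[OF refl ev[OF that] refl] by simp
  moreover have "continuous_on U F \<longleftrightarrow> continuous_on U G"
    by (rule continuous_on_cong[OF refl Suc.prems])
  ultimately show ?case
    using Suc.IH[of "pderivative _ F" "pderivative _ G"] unfolding C_k_on_Suc by meson
qed

lemma C_k_on_SucD: "C_k_on (Suc k) N U F \<Longrightarrow> C_k_on k N U F"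
proof (induction k arbitrary: F)
  case (Suc k)
  then show ?case unfolding C_k_on_Suc[of "Suc k"] C_k_on_Suc[of k] by blast
qed simp

text \<open>Lets the closure proofs name partial derivatives in closed form;
  \<open>C_k_on_cong\<close> carries the result over to \<open>pderivative\<close>.\<close>

lemma C_k_on_SucI:
  assumes "continuous_on U F"
    and "\<And>i p. i < N \<Longrightarrow> p \<in> U \<Longrightarrow> ((\<lambda>s. F (p(i := s))) has_real_derivative F' i p) (at (p i))"
    and "\<And>i. i < N \<Longrightarrow> C_k_on k N U (F' i)"
  shows "C_k_on (Suc k) N U F"
proof -
  have "C_k_on k N U (pderivative i F)" if "i < N" for i
    using C_k_on_cong[of "pderivative i F" "F' i" k] assms(2,3) that
    by (simp add: pderivative_def DERIV_imp_deriv)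
  then show ?thesis
    unfolding C_k_on_Suc using assms by (auto simp: real_differentiable_def)
qed

lemma C_k_on_SucE:
  assumes "C_k_on (Suc k) N U F"
  shows "continuous_on U F"
    and "\<And>i p. i < N \<Longrightarrow> p \<in> U \<Longrightarrow>
      ((\<lambda>s. F (p(i := s))) has_real_derivative pderivative i F p) (at (p i))"
    and "\<And>i. i < N \<Longrightarrow> C_k_on k N U (pderivative i F)"
  using assms unfolding C_k_on_Suc
  by (auto simp: pderivative_def DERIV_deriv_iff_real_differentiable)

lemma C_k_on_const: "C_k_on k N U (\<lambda>_. c)"
proof (induction k arbitrary: c)
  case (Suc k)
  show ?case
    by (rule C_k_on_SucI[where F' = "\<lambda>_ _. 0"]) (auto intro: Suc)
qed (simp add: continuous_map_Euclidean_subspace_iff[OF U])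

lemma C_k_on_coordinate: "C_k_on k N U (\<lambda>p. p j)"
proof (cases k)
  case 0
  then show ?thesis
    by (simp add: continuous_map_Euclidean_subspace_iff[OF U]
        continuous_on_subset[OF continuous_on_product_coordinates])
next
  case (Suc k')
  have "C_k_on (Suc k') N U (\<lambda>p. p j)"
    by (rule C_k_on_SucI[where F' = "\<lambda>i _. if i = j then 1 else 0"])
      (auto intro: C_k_on_const continuous_on_subset[OF continuous_on_product_coordinates])
  with Suc show ?thesis by simp
qed

lemma C_k_on_add:
  "C_k_on k N U F \<Longrightarrow> C_k_on k N U G \<Longrightarrow> C_k_on k N U (\<lambda>p. F p + G p)"
proof (induction k arbitrary: F G)
  case (Suc k)
  note F = C_k_on_SucE[OF Suc.prems(1)] and G = C_k_on_SucE[OF Suc.prems(2)]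
  show ?case
  proof (rule C_k_on_SucI[where F' = "\<lambda>i p. pderivative i F p + pderivative i G p"])
    show "continuous_on U (\<lambda>p. F p + G p)" using F(1) G(1) by (rule continuous_on_add)
    show "((\<lambda>s. F (p(i := s)) + G (p(i := s))) has_real_derivative
        pderivative i F p + pderivative i G p) (at (p i))" if "i < N" "p \<in> U" for i p
      by (rule DERIV_add F(2) G(2) that)+
    show "C_k_on k N U (\<lambda>p. pderivative i F p + pderivative i G p)" if "i < N" for i
      by (intro Suc.IH F(3) G(3) that)
  qed
qed (simp add: continuous_map_Euclidean_subspace_iff[OF U] continuous_on_add)

lemma C_k_on_mult:
  "C_k_on k N U F \<Longrightarrow> C_k_on k N U G \<Longrightarrow> C_k_on k N U (\<lambda>p. F p * G p)"
proof (induction k arbitrary: F G)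
  case (Suc k)
  note F = C_k_on_SucE[OF Suc.prems(1)] and G = C_k_on_SucE[OF Suc.prems(2)]
  show ?case
  proof (rule C_k_on_SucI[where F' = "\<lambda>i p. pderivative i F p * G p + F p * pderivative i G p"])
    show "continuous_on U (\<lambda>p. F p * G p)" using F(1) G(1) by (rule continuous_on_mult)
    show "((\<lambda>s. F (p(i := s)) * G (p(i := s))) has_real_derivative
        pderivative i F p * G p + F p * pderivative i G p) (at (p i))" if "i < N" "p \<in> U" for i p
      by (rule DERIV_cong[OF DERIV_mult[OF F(2)[OF that] G(2)[OF that]]]) simp
    \<comment> \<open>The product rule leaves \<open>F\<close> and \<open>G\<close> themselves as
      factors, hence the descent from order \<open>Suc k\<close> to \<open>k\<close>.\<close>
    show "C_k_on k N U (\<lambda>p. pderivative i F p * G p + F p * pderivative i G p)" if "i < N" for i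
      by (intro C_k_on_add Suc.IH F(3) G(3) that C_k_on_SucD[OF Suc.prems(1)]
          C_k_on_SucD[OF Suc.prems(2)])
  qed
qed (simp add: continuous_map_Euclidean_subspace_iff[OF U] continuous_on_mult)

text \<open>Proved jointly, since each function occurs in the derivative of the other.\<close>

lemma C_k_on_sin_cos:
  "C_k_on k N U F \<Longrightarrow> C_k_on k N U (\<lambda>p. sin (F p)) \<and> C_k_on k N U (\<lambda>p. cos (F p))"
proof (induction k arbitrary: F)
  case (Suc k)
  note F = C_k_on_SucE[OF Suc.prems]
  have IH: "C_k_on k N U (\<lambda>p. sin (F p))" "C_k_on k N U (\<lambda>p. cos (F p))"
    using Suc.IH[OF C_k_on_SucD[OF Suc.prems]] by auto
  have "C_k_on (Suc k) N U (\<lambda>p. sin (F p))"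
  proof (rule C_k_on_SucI[where F' = "\<lambda>i p. cos (F p) * pderivative i F p"])
    show "((\<lambda>s. sin (F (p(i := s)))) has_real_derivative cos (F p) * pderivative i F p) (at (p i))"
      if "i < N" "p \<in> U" for i p
      by (rule DERIV_cong[OF DERIV_chain2[OF DERIV_sin F(2)[OF that]]]) simp
  qed (use F IH in \<open>auto intro: continuous_on_sin continuous_on_cos C_k_on_mult\<close>)
  moreover have "C_k_on (Suc k) N U (\<lambda>p. cos (F p))"
  proof (rule C_k_on_SucI[where F' = "\<lambda>i p. (- 1) * (sin (F p) * pderivative i F p)"])
    show "((\<lambda>s. cos (F (p(i := s)))) has_real_derivative
        (- 1) * (sin (F p) * pderivative i F p)) (at (p i))"
      if "i < N" "p \<in> U" for i p
      by (rule DERIV_cong[OF DERIV_chain2[OF DERIV_cos F(2)[OF that]]]) simp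
    show "C_k_on k N U (\<lambda>p. (- 1) * (sin (F p) * pderivative i F p))" if "i < N" for i
      by (intro C_k_on_mult C_k_on_const IH F(3) that)
  qed (rule continuous_on_cos[OF F(1)])
  ultimately show ?case ..
qed (simp add: continuous_map_Euclidean_subspace_iff[OF U] continuous_on_sin continuous_on_cos)

text \<open>The derivative is a product of a partial derivative of \<open>F\<close> with inverses of
  the same \<open>F\<close>, so the induction hypothesis applies to it directly.\<close>

lemma C_k_on_inverse:
  assumes "\<And>p. p \<in> U \<Longrightarrow> F p \<noteq> 0"
  shows "C_k_on k N U F \<Longrightarrow> C_k_on k N U (\<lambda>p. inverse (F p))"
proof (induction k)
  case 0
  then show ?case
    using assms by (simp add: continuous_map_Euclidean_subspace_iff[OF U] continuous_on_inverse)
next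
  case (Suc k)
  note F = C_k_on_SucE[OF Suc.prems]
  let ?F' = "\<lambda>i p. (- 1) * (pderivative i F p * (inverse (F p) * inverse (F p)))"
  show ?case
  proof (rule C_k_on_SucI[where F' = ?F'])
    show "continuous_on U (\<lambda>p. inverse (F p))" using F(1) assms by (simp add: continuous_on_inverse)
    show "((\<lambda>s. inverse (F (p(i := s)))) has_real_derivative ?F' i p) (at (p i))"
      if "i < N" "p \<in> U" for i p
      using assms[OF that(2)]
      by (intro DERIV_cong[OF DERIV_inverse_fun[OF F(2)[OF that]]]) simp_all
    show "C_k_on k N U (?F' i)" if "i < N" for i
      using Suc.IH[OF C_k_on_SucD[OF Suc.prems]] F(3)[OF that]
      by (intro C_k_on_mult C_k_on_const)
  qed
qed

lemma smooth_fun_on_const: "smooth_fun_on N U (\<lambda>_. c)"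
  by (simp add: smooth_fun_on_def C_k_on_const)

lemma smooth_fun_on_coordinate: "smooth_fun_on N U (\<lambda>p. p j)"
  by (simp add: smooth_fun_on_def C_k_on_coordinate)

lemma smooth_fun_on_add:
  "smooth_fun_on N U F \<Longrightarrow> smooth_fun_on N U G \<Longrightarrow> smooth_fun_on N U (\<lambda>p. F p + G p)"
  by (simp add: smooth_fun_on_def C_k_on_add)

lemma smooth_fun_on_mult:
  "smooth_fun_on N U F \<Longrightarrow> smooth_fun_on N U G \<Longrightarrow> smooth_fun_on N U (\<lambda>p. F p * G p)"
  by (simp add: smooth_fun_on_def C_k_on_mult)

lemma smooth_fun_on_minus: "smooth_fun_on N U F \<Longrightarrow> smooth_fun_on N U (\<lambda>p. - F p)"
  using smooth_fun_on_mult[OF smooth_fun_on_const[of "- 1"], of F] by simp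

lemma smooth_fun_on_diff:
  "smooth_fun_on N U F \<Longrightarrow> smooth_fun_on N U G \<Longrightarrow> smooth_fun_on N U (\<lambda>p. F p - G p)"
  using smooth_fun_on_add[OF _ smooth_fun_on_minus, of F G] by simp

lemma smooth_fun_on_power: "smooth_fun_on N U F \<Longrightarrow> smooth_fun_on N U (\<lambda>p. F p ^ k)"
  by (induction k) (simp_all add: smooth_fun_on_const smooth_fun_on_mult)

lemma smooth_fun_on_sin: "smooth_fun_on N U F \<Longrightarrow> smooth_fun_on N U (\<lambda>p. sin (F p))"
  by (simp add: smooth_fun_on_def C_k_on_sin_cos)

lemma smooth_fun_on_cos: "smooth_fun_on N U F \<Longrightarrow> smooth_fun_on N U (\<lambda>p. cos (F p))"
  by (simp add: smooth_fun_on_def C_k_on_sin_cos)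

lemma smooth_fun_on_divide:
  "smooth_fun_on N U F \<Longrightarrow> smooth_fun_on N U G \<Longrightarrow> (\<And>p. p \<in> U \<Longrightarrow> G p \<noteq> 0) \<Longrightarrow>
    smooth_fun_on N U (\<lambda>p. F p / G p)"
  unfolding divide_inverse
  by (rule smooth_fun_on_mult) (simp_all add: smooth_fun_on_def C_k_on_inverse)

lemma smooth_fun_on_imp_continuous_on: "smooth_fun_on N U F \<Longrightarrow> continuous_on U F"
  by (rule C_k_on_SucE(1)[of 0]) (simp only: smooth_fun_on_def)

lemmas smooth_intros = smooth_fun_on_const smooth_fun_on_coordinate smooth_fun_on_add
  smooth_fun_on_diff smooth_fun_on_minus smooth_fun_on_mult smooth_fun_on_power
  smooth_fun_on_sin smooth_fun_on_cos

end

subsection \<open>Derivatives along a control system\<close>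

text \<open>A relation, because a value of \<open>deriv\<close> does not witness differentiability;
  the witnesses \<open>Y'\<close> let sum, product and chain rules compose. \<open>Y\<close> depends
  on the state alone, so there is no time term.\<close>

definition has_total_derivative ::
    "nat \<Rightarrow> system \<Rightarrow> real \<Rightarrow> vec \<Rightarrow> vec \<Rightarrow> (vec \<Rightarrow> real) \<Rightarrow> real \<Rightarrow> bool" where
  "has_total_derivative n f t x u Y D \<longleftrightarrow>
     (\<exists>Y'. (\<forall>j<n. ((\<lambda>s. Y (x(j := s))) has_real_derivative Y' j) (at (x j))) \<and>
       D = (\<Sum>j<n. Y' j * f t x u j))"

lemma has_total_derivative_imp:
  assumes "has_total_derivative n f t x u Y D"
  shows "total_derivative n f (\<lambda>_. Y) t x u = D"
proof -
  obtain Y' where Y: "\<forall>j<n. ((\<lambda>s. Y (x(j := s))) has_real_derivative Y' j) (at (x j))"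
    and D: "D = (\<Sum>j<n. Y' j * f t x u j)"
    using assms unfolding has_total_derivative_def by blast
  have "deriv (\<lambda>s. Y (x(j := s))) (x j) = Y' j" if "j < n" for j
    using Y that by (intro DERIV_imp_deriv) blast
  then show ?thesis
    by (simp add: total_derivative_def D)
qed

context
  fixes n :: nat and f :: system and t :: real and x u :: vec
begin

lemma has_total_derivativeI:
  assumes "\<And>j. j < n \<Longrightarrow> ((\<lambda>s. Y (x(j := s))) has_real_derivative Y' j) (at (x j))"
    and "D = (\<Sum>j<n. Y' j * f t x u j)"
  shows "has_total_derivative n f t x u Y D"
  using assms unfolding has_total_derivative_def by blast

lemma has_total_derivative_const: "has_total_derivative n f t x u (\<lambda>_. c) 0"
  by (rule has_total_derivativeI[where Y' = "\<lambda>_. 0"]) auto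

lemma has_total_derivative_coordinate:
  "i < n \<Longrightarrow> has_total_derivative n f t x u (\<lambda>q. q i) (f t x u i)"
proof (rule has_total_derivativeI[where Y' = "\<lambda>j. if j = i then 1 else 0"])
  assume "i < n"
  have "(\<Sum>j<n. (if j = i then 1 else 0) * f t x u j) = (\<Sum>j<n. if j = i then f t x u j else 0)"
    by (intro sum.cong) auto
  then show "f t x u i = (\<Sum>j<n. (if j = i then 1 else 0) * f t x u j)"
    using \<open>i < n\<close> by simp
qed auto

lemma has_total_derivative_add:
  assumes "has_total_derivative n f t x u Y D" "has_total_derivative n f t x u Z E"
  shows "has_total_derivative n f t x u (\<lambda>q. Y q + Z q) (D + E)"
proof -
  obtain Y' where Y: "\<And>j. j < n \<Longrightarrow> ((\<lambda>s. Y (x(j := s))) has_real_derivative Y' j) (at (x j))"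
    and D: "D = (\<Sum>j<n. Y' j * f t x u j)"
    using assms(1) unfolding has_total_derivative_def by blast
  obtain Z' where Z: "\<And>j. j < n \<Longrightarrow> ((\<lambda>s. Z (x(j := s))) has_real_derivative Z' j) (at (x j))"
    and E: "E = (\<Sum>j<n. Z' j * f t x u j)"
    using assms(2) unfolding has_total_derivative_def by blast
  show ?thesis
  proof (rule has_total_derivativeI)
    show "((\<lambda>s. Y (x(j := s)) + Z (x(j := s))) has_real_derivative Y' j + Z' j) (at (x j))"
      if "j < n" for j
      by (rule DERIV_add Y Z that)+
  qed (simp add: D E algebra_simps sum.distrib)
qed

lemma has_total_derivative_mult:
  assumes "has_total_derivative n f t x u Y D" "has_total_derivative n f t x u Z E"
  shows "has_total_derivative n f t x u (\<lambda>q. Y q * Z q) (D * Z x + Y x * E)"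
proof -
  obtain Y' where Y: "\<And>j. j < n \<Longrightarrow> ((\<lambda>s. Y (x(j := s))) has_real_derivative Y' j) (at (x j))"
    and D: "D = (\<Sum>j<n. Y' j * f t x u j)"
    using assms(1) unfolding has_total_derivative_def by blast
  obtain Z' where Z: "\<And>j. j < n \<Longrightarrow> ((\<lambda>s. Z (x(j := s))) has_real_derivative Z' j) (at (x j))"
    and E: "E = (\<Sum>j<n. Z' j * f t x u j)"
    using assms(2) unfolding has_total_derivative_def by blast
  show ?thesis
  proof (rule has_total_derivativeI)
    show "((\<lambda>s. Y (x(j := s)) * Z (x(j := s))) has_real_derivative Y' j * Z x + Y x * Z' j) (at (x j))"
      if "j < n" for j
      by (rule DERIV_cong[OF DERIV_mult[OF Y[OF that] Z[OF that]]]) simp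
  qed (simp add: D E algebra_simps sum.distrib sum_distrib_left)
qed

lemma has_total_derivative_chain:
  assumes "has_total_derivative n f t x u Y D" "(h has_real_derivative h') (at (Y x))"
  shows "has_total_derivative n f t x u (\<lambda>q. h (Y q)) (h' * D)"
proof -
  obtain Y' where Y: "\<And>j. j < n \<Longrightarrow> ((\<lambda>s. Y (x(j := s))) has_real_derivative Y' j) (at (x j))"
    and D: "D = (\<Sum>j<n. Y' j * f t x u j)"
    using assms(1) unfolding has_total_derivative_def by blast
  show ?thesis
  proof (rule has_total_derivativeI)
    show "((\<lambda>s. h (Y (x(j := s)))) has_real_derivative h' * Y' j) (at (x j))" if "j < n" for j
      by (rule DERIV_chain2[OF _ Y[OF that]]) (simp add: assms(2))
  qed (simp add: D mult.assoc sum_distrib_left)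
qed

lemmas has_total_derivative_sin = has_total_derivative_chain[OF _ DERIV_sin]
lemmas has_total_derivative_cos = has_total_derivative_chain[OF _ DERIV_cos]

lemma has_total_derivative_minus:
  "has_total_derivative n f t x u Y D \<Longrightarrow> has_total_derivative n f t x u (\<lambda>q. - Y q) (- D)"
  using has_total_derivative_mult[OF has_total_derivative_const[of "- 1"], of Y D] by simp

lemma has_total_derivative_diff:
  assumes "has_total_derivative n f t x u Y D" "has_total_derivative n f t x u Z E"
  shows "has_total_derivative n f t x u (\<lambda>q. Y q - Z q) (D - E)"
  using has_total_derivative_add[OF assms(1) has_total_derivative_minus[OF assms(2)]] by simp

lemma has_total_derivative_power:
  "has_total_derivative n f t x u Y D \<Longrightarrow>
    has_total_derivative n f t x u (\<lambda>q. Y q ^ k) (real k * Y x ^ (k - 1) * D)"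
  using has_total_derivative_chain[OF _ DERIV_pow] by (simp add: mult_ac)

text \<open>The differentiation rules build a derivative syntactically; its agreement with the
  intended closed form is then a separate algebraic goal.\<close>

lemma has_total_derivative_eq_rhs:
  "has_total_derivative n f t x u Y D \<Longrightarrow> D = E \<Longrightarrow> has_total_derivative n f t x u Y E"
  by simp

lemmas total_derivative_intros = has_total_derivative_const
  has_total_derivative_add has_total_derivative_diff has_total_derivative_minus
  has_total_derivative_mult has_total_derivative_power
  has_total_derivative_sin has_total_derivative_cos

end


section \<open>Points given by coordinate lists\<close>

definition vec_of :: "real list \<Rightarrow> vec" where
  "vec_of xs = (\<lambda>i. if i < length xs then xs ! i else 0)"

lemmas Suc_numerals = numeral_2_eq_2[symmetric] numeral_3_eq_3[symmetric]

lemma All_less_numeral: "(\<forall>i < numeral k. P i) \<longleftrightarrow> P (pred_numeral k) \<and> (\<forall>i < pred_numeral k. P i)"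
  by (simp add: numeral_eq_Suc All_less_Suc)

lemma less_pred_numeral: "(i::nat) < numeral k \<longleftrightarrow> i = pred_numeral k \<or> i < pred_numeral k"
  by (auto simp: numeral_eq_Suc)

lemma vec_of_topspace: "length xs = N \<Longrightarrow> vec_of xs \<in> topspace (Euclidean_space N)"
  by (simp add: vec_of_def topspace_Euclidean_space)

lemma vec_eqI:
  assumes "p \<in> topspace (Euclidean_space N)" "q \<in> topspace (Euclidean_space N)" "\<forall>i<N. p i = q i"
  shows "p = q"
  using assms by (intro ext) (metis (mono_tags, lifting) mem_Collect_eq not_le topspace_Euclidean_space)

subsection \<open>The flat output\<close>

text \<open>\<open>\<rho> i\<close> stands for the \<open>i\<close>-th time derivative of the yaw rate \<open>r\<close>, and \<open>g\<close>, \<open>b\<close> for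
  \<open>\<gamma>1\<close>, \<open>\<beta>2\<close>. The \<open>n\<close>-th derivative of the flat output has coefficients \<open>xn\<close>, \<open>hn\<close>, \<open>kn\<close> at
  \<open>\<xi>\<close>, \<open>\<eta>\<close>, \<open>w\<close>; a prefix \<open>d\<close> or \<open>dd\<close> marks time derivatives of coefficients. The choice of
  \<open>h0\<close> and \<open>k0\<close> makes \<open>\<xi>\<close> cancel from the first derivative, and \<open>delta\<close> is the coefficient of
  \<open>\<xi>\<close> in the second and of the surge speed in the third.\<close>

context
  fixes g b :: real
begin

definition h0 where "h0 \<rho> = g * (\<rho> 1 + b * \<rho> 0)" for \<rho> :: vec
definition dh0 where "dh0 \<rho> = g * (\<rho> 2 + b * \<rho> 1)" for \<rho> :: vec
definition h1 where "h1 \<rho> = g * (\<rho> 2 + b * \<rho> 1) + g * (1 + g) * \<rho> 0 ^ 3" for \<rho> :: vec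
definition h2 where
  "h2 \<rho> = g * (\<rho> 3 + b * \<rho> 2) + g * (4 + 5 * g) * (\<rho> 0 ^ 2 * \<rho> 1) - g * b * \<rho> 0 ^ 3" for \<rho> :: vec
definition dh2 where
  "dh2 \<rho> = g * (\<rho> 4 + b * \<rho> 3) + g * (4 + 5 * g) * (2 * \<rho> 0 * \<rho> 1 ^ 2 + \<rho> 0 ^ 2 * \<rho> 2)
     - 3 * g * b * (\<rho> 0 ^ 2 * \<rho> 1)" for \<rho> :: vec
definition ddh2 where
  "ddh2 \<rho> = g * (\<rho> 5 + b * \<rho> 4)
     + g * (4 + 5 * g) * (2 * \<rho> 1 ^ 3 + 6 * \<rho> 0 * \<rho> 1 * \<rho> 2 + \<rho> 0 ^ 2 * \<rho> 3)
     - 3 * g * b * (2 * \<rho> 0 * \<rho> 1 ^ 2 + \<rho> 0 ^ 2 * \<rho> 2)" for \<rho> :: vec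

definition k0 where "k0 \<rho> = (1 + g) * \<rho> 0" for \<rho> :: vec
definition dk0 where "dk0 \<rho> = (1 + g) * \<rho> 1" for \<rho> :: vec
definition k1 where "k1 \<rho> = (1 + 2 * g) * \<rho> 1 - b * \<rho> 0" for \<rho> :: vec
definition k2 where
  "k2 \<rho> = (1 + 3 * g) * \<rho> 2 - (2 + g) * b * \<rho> 1 + g * (1 + g) * \<rho> 0 ^ 3 + b ^ 2 * \<rho> 0" for \<rho> :: vec
definition dk2 where
  "dk2 \<rho> = (1 + 3 * g) * \<rho> 3 - (2 + g) * b * \<rho> 2 + 3 * g * (1 + g) * (\<rho> 0 ^ 2 * \<rho> 1)
     + b ^ 2 * \<rho> 1" for \<rho> :: vec
definition ddk2 where
  "ddk2 \<rho> = (1 + 3 * g) * \<rho> 4 - (2 + g) * b * \<rho> 3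
     + 3 * g * (1 + g) * (2 * \<rho> 0 * \<rho> 1 ^ 2 + \<rho> 0 ^ 2 * \<rho> 2) + b ^ 2 * \<rho> 2" for \<rho> :: vec

definition delta where
  "delta \<rho> = g * ((1 + 2 * g) * \<rho> 1 ^ 2 - (1 + g) * (\<rho> 0 * \<rho> 2) + (g - 1) * b * (\<rho> 0 * \<rho> 1)
     - (1 + g) ^ 2 * \<rho> 0 ^ 4 - b ^ 2 * \<rho> 0 ^ 2)" for \<rho> :: vec
definition ddelta where
  "ddelta \<rho> = g * (2 * (1 + 2 * g) * (\<rho> 1 * \<rho> 2) - (1 + g) * (\<rho> 1 * \<rho> 2 + \<rho> 0 * \<rho> 3)
     + (g - 1) * b * (\<rho> 1 ^ 2 + \<rho> 0 * \<rho> 2) - 4 * (1 + g) ^ 2 * (\<rho> 0 ^ 3 * \<rho> 1)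
     - 2 * b ^ 2 * (\<rho> 0 * \<rho> 1))" for \<rho> :: vec
definition dddelta where
  "dddelta \<rho> = g * (2 * (1 + 2 * g) * (\<rho> 2 ^ 2 + \<rho> 1 * \<rho> 3)
     - (1 + g) * (\<rho> 2 ^ 2 + 2 * \<rho> 1 * \<rho> 3 + \<rho> 0 * \<rho> 4)
     + (g - 1) * b * (3 * \<rho> 1 * \<rho> 2 + \<rho> 0 * \<rho> 3)
     - 4 * (1 + g) ^ 2 * (3 * \<rho> 0 ^ 2 * \<rho> 1 ^ 2 + \<rho> 0 ^ 3 * \<rho> 2)
     - 2 * b ^ 2 * (\<rho> 1 ^ 2 + \<rho> 0 * \<rho> 2))" for \<rho> :: vec

definition x3 where "x3 \<rho> = ddelta \<rho> - k0 \<rho> * h2 \<rho> + h0 \<rho> * k2 \<rho>"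
definition dx3 where
  "dx3 \<rho> = dddelta \<rho> - (dk0 \<rho> * h2 \<rho> + k0 \<rho> * dh2 \<rho>) + (dh0 \<rho> * k2 \<rho> + h0 \<rho> * dk2 \<rho>)"
definition h3 where "h3 \<rho> = delta \<rho> * \<rho> 0 + dh2 \<rho> + g * \<rho> 0 ^ 2 * k2 \<rho>"
definition dh3 where
  "dh3 \<rho> = ddelta \<rho> * \<rho> 0 + delta \<rho> * \<rho> 1 + ddh2 \<rho> + 2 * g * \<rho> 0 * \<rho> 1 * k2 \<rho> + g * \<rho> 0 ^ 2 * dk2 \<rho>"
definition k3 where "k3 \<rho> = dk2 \<rho> + h2 \<rho> - b * k2 \<rho>"
definition dk3 where "dk3 \<rho> = ddk2 \<rho> + dh2 \<rho> - b * dk2 \<rho>"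

lemmas base_defs = h0_def dh0_def h1_def h2_def dh2_def ddh2_def k0_def dk0_def k1_def k2_def dk2_def
  ddk2_def delta_def ddelta_def dddelta_def
lemmas coeff_defs = base_defs x3_def dx3_def h3_def dh3_def k3_def dk3_def

definition F0 where "F0 \<rho> \<eta> w = h0 \<rho> * \<eta> + k0 \<rho> * w"
definition F1 where "F1 \<rho> \<eta> w = h1 \<rho> * \<eta> + k1 \<rho> * w"
definition F2 where "F2 \<rho> \<xi> \<eta> w = delta \<rho> * \<xi> + h2 \<rho> * \<eta> + k2 \<rho> * w"
definition F3 where "F3 \<rho> \<xi> \<eta> w u = delta \<rho> * u + x3 \<rho> * \<xi> + h3 \<rho> * \<eta> + k3 \<rho> * w"
text \<open>The fourth derivative without its surge acceleration term, whose coefficient is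
  \<open>delta \<rho>\<close>. The fifth derivative of r first appears here, through
  \<open>dh3\<close>.\<close>

definition F4_drift where
  "F4_drift \<rho> \<xi> \<eta> w u = (ddelta \<rho> + x3 \<rho>) * u + (dx3 \<rho> - k0 \<rho> * h3 \<rho> + h0 \<rho> * k3 \<rho>) * \<xi>
     + (dh3 \<rho> + \<rho> 0 * x3 \<rho> + g * \<rho> 0 ^ 2 * k3 \<rho>) * \<eta> + (dk3 \<rho> + h3 \<rho> - b * k3 \<rho>) * w"

text \<open>The determinant of \<open>F0\<close>, \<open>F1\<close> in \<eta>, w. One nonvanishing
  condition thus serves this pair as well as the later solutions for \<xi> and the surge
  speed.\<close>

lemma delta_eq: "delta \<rho> = h0 \<rho> * k1 \<rho> - h1 \<rho> * k0 \<rho>"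
  unfolding base_defs by algebra

text \<open>The coefficients reach at most the fourth derivative of r, so the jet may be padded
  arbitrarily from index 5 on.\<close>

lemma F_cong:
  assumes "\<And>i. i < 5 \<Longrightarrow> \<rho> i = \<rho>' i"
  shows "F0 \<rho> = F0 \<rho>'" "F1 \<rho> = F1 \<rho>'" "F2 \<rho> = F2 \<rho>'" "F3 \<rho> = F3 \<rho>'"
  by (auto simp: F0_def F1_def F2_def F3_def coeff_defs assms fun_eq_iff)

text \<open>The frame equations enter as hypotheses. \<open>\<rho>'\<close> is the jet at
  \<open>x\<close> completed at index 5 by the fifth derivative of r, in the application an input;
  \<open>v\<close> is the surge speed and \<open>\<nu>\<close> its derivative.\<close>

context
  fixes n f t x u and \<rho> :: "vec \<Rightarrow> vec" and \<rho>' :: vec and \<xi> \<eta> w v :: "vec \<Rightarrow> real" and \<nu> :: real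
  assumes \<rho>: "\<And>i. i < 5 \<Longrightarrow> has_total_derivative n f t x u (\<lambda>q. \<rho> q i) (\<rho>' (Suc i))"
    and \<rho>': "\<And>i. i < 5 \<Longrightarrow> \<rho>' i = \<rho> x i"
    and \<xi>: "has_total_derivative n f t x u \<xi> (v x + \<rho> x 0 * \<eta> x)"
    and \<eta>: "has_total_derivative n f t x u \<eta> (w x - (1 + g) * \<rho> x 0 * \<xi> x)"
    and w: "has_total_derivative n f t x u w (- b * w x + h0 (\<rho> x) * \<xi> x + g * \<rho> x 0 ^ 2 * \<eta> x)"
    and v: "has_total_derivative n f t x u v \<nu>"
begin

lemma jet_total_derivative:
  "has_total_derivative n f t x u (\<lambda>q. \<rho> q 0) (\<rho>' 1)"
  "has_total_derivative n f t x u (\<lambda>q. \<rho> q 1) (\<rho>' 2)"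
  "has_total_derivative n f t x u (\<lambda>q. \<rho> q (Suc 0)) (\<rho>' 2)"
  "has_total_derivative n f t x u (\<lambda>q. \<rho> q 2) (\<rho>' 3)"
  "has_total_derivative n f t x u (\<lambda>q. \<rho> q 3) (\<rho>' 4)"
  "has_total_derivative n f t x u (\<lambda>q. \<rho> q 4) (\<rho>' 5)"
  using \<rho>[of 0] \<rho>[of 1] \<rho>[of 2] \<rho>[of 3] \<rho>[of 4] by (simp_all add: numeral_eq_Suc)

text \<open>The derivatives of \<open>h1\<close> and \<open>k1\<close> are expressed through the
  recursions h2 = h1' + g r^2 k1 and k2 = k1' + h1 - b k1, the form in which differentiating
  \<open>F1\<close> needs them.\<close>

lemma base_total_derivative:
  "has_total_derivative n f t x u (\<lambda>q. h0 (\<rho> q)) (dh0 \<rho>')"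
  "has_total_derivative n f t x u (\<lambda>q. h1 (\<rho> q)) (h2 \<rho>' - g * \<rho>' 0 ^ 2 * k1 \<rho>')"
  "has_total_derivative n f t x u (\<lambda>q. h2 (\<rho> q)) (dh2 \<rho>')"
  "has_total_derivative n f t x u (\<lambda>q. dh2 (\<rho> q)) (ddh2 \<rho>')"
  "has_total_derivative n f t x u (\<lambda>q. k0 (\<rho> q)) (dk0 \<rho>')"
  "has_total_derivative n f t x u (\<lambda>q. k1 (\<rho> q)) (k2 \<rho>' - h1 \<rho>' + b * k1 \<rho>')"
  "has_total_derivative n f t x u (\<lambda>q. k2 (\<rho> q)) (dk2 \<rho>')"
  "has_total_derivative n f t x u (\<lambda>q. dk2 (\<rho> q)) (ddk2 \<rho>')"
  "has_total_derivative n f t x u (\<lambda>q. delta (\<rho> q)) (ddelta \<rho>')"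
  "has_total_derivative n f t x u (\<lambda>q. ddelta (\<rho> q)) (dddelta \<rho>')"
  unfolding base_defs
  by (rule has_total_derivative_eq_rhs, (rule jet_total_derivative total_derivative_intros)+,
      simp add: \<rho>'[symmetric] algebra_simps power2_eq_square power3_eq_cube power4_eq_xxxx)+

lemma top_total_derivative:
  "has_total_derivative n f t x u (\<lambda>q. x3 (\<rho> q)) (dx3 \<rho>')"
  "has_total_derivative n f t x u (\<lambda>q. h3 (\<rho> q)) (dh3 \<rho>')"
  "has_total_derivative n f t x u (\<lambda>q. k3 (\<rho> q)) (dk3 \<rho>')"
proof -
  \<comment> \<open>None of these reaches the fifth derivative of r, so \<open>\<rho> x\<close> and
    \<open>\<rho>'\<close> give the same value.\<close>
  have c: "c (\<rho> x) = c \<rho>'" if "c \<in> {h0, h2, k0, k2, delta}" for c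
    using that by (auto simp: base_defs \<rho>')
  note jets = base_total_derivative jet_total_derivative(1) total_derivative_intros
  show "has_total_derivative n f t x u (\<lambda>q. x3 (\<rho> q)) (dx3 \<rho>')"
    unfolding x3_def dx3_def
    by (rule has_total_derivative_eq_rhs, (rule jets)+) (simp add: c)
  show "has_total_derivative n f t x u (\<lambda>q. h3 (\<rho> q)) (dh3 \<rho>')"
    unfolding h3_def dh3_def
    by (rule has_total_derivative_eq_rhs, (rule jets)+) (simp add: c \<rho>'[symmetric])
  show "has_total_derivative n f t x u (\<lambda>q. k3 (\<rho> q)) (dk3 \<rho>')"
    unfolding k3_def dk3_def
    by (rule has_total_derivative_eq_rhs, (rule jets)+) simp
qed

text \<open>Differentiating X \<xi> + H \<eta> + K w yields the coefficients X' - (1 + g) r H + h0 K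
  at \<xi>, H' + r X + g r^2 K at \<eta>, K' + H - b K at w, and X at the surge speed. Iterating
  from \<open>F0\<close> gives \<open>F1\<close> to \<open>F3\<close>; the last line also
  differentiates delta times the surge speed.\<close>

lemma F_total_derivative:
  "has_total_derivative n f t x u (\<lambda>q. F0 (\<rho> q) (\<eta> q) (w q)) (F1 \<rho>' (\<eta> x) (w x))"
  "has_total_derivative n f t x u (\<lambda>q. F1 (\<rho> q) (\<eta> q) (w q)) (F2 \<rho>' (\<xi> x) (\<eta> x) (w x))"
  "has_total_derivative n f t x u (\<lambda>q. F2 (\<rho> q) (\<xi> q) (\<eta> q) (w q)) (F3 \<rho>' (\<xi> x) (\<eta> x) (w x) (v x))"
  "has_total_derivative n f t x u (\<lambda>q. F3 (\<rho> q) (\<xi> q) (\<eta> q) (w q) (v q))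
     (delta \<rho>' * \<nu> + F4_drift \<rho>' (\<xi> x) (\<eta> x) (w x) (v x))"
proof -
  have c: "c (\<rho> x) = c \<rho>'" if "c \<in> {h0, h1, h2, h3, k0, k1, k2, k3, delta, x3}" for c
    using that by (auto simp: coeff_defs \<rho>')
  note c = c \<rho>'[of 0, symmetric]
  note jets = base_total_derivative top_total_derivative \<xi> \<eta> w v total_derivative_intros
  show "has_total_derivative n f t x u (\<lambda>q. F0 (\<rho> q) (\<eta> q) (w q)) (F1 \<rho>' (\<eta> x) (w x))"
    unfolding F0_def F1_def
    by (rule has_total_derivative_eq_rhs, (rule jets)+) (simp add: c, unfold base_defs, algebra)
  show "has_total_derivative n f t x u (\<lambda>q. F1 (\<rho> q) (\<eta> q) (w q)) (F2 \<rho>' (\<xi> x) (\<eta> x) (w x))"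
    unfolding F1_def F2_def delta_eq
    by (rule has_total_derivative_eq_rhs, (rule jets)+) (simp add: c, simp add: k0_def algebra_simps)
  show "has_total_derivative n f t x u (\<lambda>q. F2 (\<rho> q) (\<xi> q) (\<eta> q) (w q))
      (F3 \<rho>' (\<xi> x) (\<eta> x) (w x) (v x))"
    unfolding F2_def F3_def
    by (rule has_total_derivative_eq_rhs, (rule jets)+)
      (simp add: c, simp add: k0_def x3_def h3_def k3_def algebra_simps)
  show "has_total_derivative n f t x u (\<lambda>q. F3 (\<rho> q) (\<xi> q) (\<eta> q) (w q) (v q))
     (delta \<rho>' * \<nu> + F4_drift \<rho>' (\<xi> x) (\<eta> x) (w x) (v x))"
    unfolding F3_def F4_drift_def
    by (rule has_total_derivative_eq_rhs, (rule jets)+) (simp add: c, simp add: k0_def algebra_simps)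
qed

end

lemma smooth_coeffs:
  assumes U: "openin (Euclidean_space N) U" and \<rho>: "\<And>i. smooth_fun_on N U (\<lambda>p. \<rho> p i)"
  shows "smooth_fun_on N U (\<lambda>p. h0 (\<rho> p))" "smooth_fun_on N U (\<lambda>p. h1 (\<rho> p))"
    "smooth_fun_on N U (\<lambda>p. h2 (\<rho> p))" "smooth_fun_on N U (\<lambda>p. h3 (\<rho> p))"
    "smooth_fun_on N U (\<lambda>p. k0 (\<rho> p))" "smooth_fun_on N U (\<lambda>p. k1 (\<rho> p))"
    "smooth_fun_on N U (\<lambda>p. k2 (\<rho> p))" "smooth_fun_on N U (\<lambda>p. k3 (\<rho> p))"
    "smooth_fun_on N U (\<lambda>p. delta (\<rho> p))" "smooth_fun_on N U (\<lambda>p. ddelta (\<rho> p))"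
    "smooth_fun_on N U (\<lambda>p. x3 (\<rho> p))" "smooth_fun_on N U (\<lambda>p. dx3 (\<rho> p))"
    "smooth_fun_on N U (\<lambda>p. dh3 (\<rho> p))" "smooth_fun_on N U (\<lambda>p. dk3 (\<rho> p))"
  unfolding coeff_defs by (rule \<rho> smooth_intros[OF U])+

end

subsection \<open>The extended vessel\<close>

context
  fixes g g2 b1 b b3 :: real
begin

text \<open>\<open>\<zeta>\<close> carries the derivatives of r of orders 1 to 4;
  \<open>\<nu> 0\<close> is the fifth, that is, the sixth derivative of the heading.\<close>

definition ext_dynamics :: "real \<Rightarrow> vec \<Rightarrow> vec \<Rightarrow> vec \<Rightarrow> vec" where
  "ext_dynamics t q \<zeta> \<nu> = vec_of [\<zeta> 1, \<zeta> 2, \<zeta> 3, \<nu> 0]"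

text \<open>The surge and yaw equations solved for the inputs, so that u' = \<open>\<nu> 1\<close>
  and r' = \<open>\<zeta> 0\<close>.\<close>

definition ext_feedback :: "real \<Rightarrow> vec \<Rightarrow> vec \<Rightarrow> vec \<Rightarrow> vec" where
  "ext_feedback t q \<zeta> \<nu> =
     vec_of [\<nu> 1 - 1 / g * q 4 * q 5 + b1 * q 3, \<zeta> 0 - g2 * q 3 * q 4 + b3 * q 5]"

definition ext_vessel :: system where
  "ext_vessel = extended_system 6 2 (vessel g g2 b1 b b3) 4 ext_dynamics ext_feedback"

lemma ext_vessel_nth:
  assumes "i < 10"
  shows "ext_vessel t q \<nu> i = vec_of
    [q 3 * cos (q 2) - q 4 * sin (q 2), q 3 * sin (q 2) + q 4 * cos (q 2), q 5, \<nu> 1,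
     - g * q 3 * q 5 - b * q 4, q 6, q 7, q 8, q 9, \<nu> 0] i"
proof -
  have "\<forall>i<10. ext_vessel t q \<nu> i = vec_of
    [q 3 * cos (q 2) - q 4 * sin (q 2), q 3 * sin (q 2) + q 4 * cos (q 2), q 5, \<nu> 1,
     - g * q 3 * q 5 - b * q 4, q 6, q 7, q 8, q 9, \<nu> 0] i"
    by (simp add: All_less_numeral All_less_Suc ext_vessel_def extended_system_def vessel_def Let_def
        join_def slice_def vec_of_def ext_dynamics_def ext_feedback_def
        Suc_numerals)
  with assms show ?thesis by blast
qed

lemma ext_vessel_coordinate:
  assumes "i < 10"
  shows "has_total_derivative 10 ext_vessel t q \<nu> (\<lambda>q. q i) (vec_of
    [q 3 * cos (q 2) - q 4 * sin (q 2), q 3 * sin (q 2) + q 4 * cos (q 2), q 5, \<nu> 1,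
     - g * q 3 * q 5 - b * q 4, q 6, q 7, q 8, q 9, \<nu> 0] i)"
  using has_total_derivative_coordinate[OF assms] ext_vessel_nth[OF assms] by metis

section \<open>The rotating frame\<close>

definition xi :: "vec \<Rightarrow> real" where "xi q = q 0 * cos (q 2) + q 1 * sin (q 2)"
definition eta :: "vec \<Rightarrow> real" where "eta q = q 1 * cos (q 2) - q 0 * sin (q 2)"
text \<open>On differentiation, g r u from \<xi>' cancels -g u r from v', which removes the surge
  speed.\<close>

definition sway :: "vec \<Rightarrow> real" where "sway q = q 4 + g * q 5 * xi q"

text \<open>The jet of \<open>r\<close> starts at position \<open>d = 5\<close> of a state, \<open>d = 6\<close> of a point of
  \<open>(t, x, u)\<close>-space and \<open>d = 2\<close> of the image of such a point in Brunovsky coordinates. The fifth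
  derivative is an input and is supplied separately.\<close>

definition jet :: "nat \<Rightarrow> real \<Rightarrow> vec \<Rightarrow> vec" where
  "jet d s p = (\<lambda>i. if i < 5 then p (d + i) else s)"

text \<open>The padding \<open>s\<close> is free because \<open>h0\<close> stops at the first
  derivative of r.\<close>

lemma frame_total_derivative:
  "has_total_derivative 10 ext_vessel t q \<nu> xi (q 3 + q 5 * eta q)"
  "has_total_derivative 10 ext_vessel t q \<nu> eta (sway q - (1 + g) * q 5 * xi q)"
  "has_total_derivative 10 ext_vessel t q \<nu> sway
    (- b * sway q + h0 g b (jet 5 s q) * xi q + g * q 5 ^ 2 * eta q)"
proof -
  note c = ext_vessel_coordinate[of _ t q \<nu>]
  \<comment> \<open>Sine and cosine act as indeterminates in the algebra, subject to this
    relation.\<close>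
  have sc: "sin (q 2) * sin (q 2) = 1 - cos (q 2) * cos (q 2)"
    using sin_cos_squared_add[of "q 2"] by (simp add: power2_eq_square)
  show x: "has_total_derivative 10 ext_vessel t q \<nu> xi (q 3 + q 5 * eta q)"
    unfolding xi_def eta_def
    by (rule has_total_derivative_eq_rhs, (rule c total_derivative_intros | simp)+)
      (simp add: vec_of_def, use sc in algebra)
  show "has_total_derivative 10 ext_vessel t q \<nu> eta (sway q - (1 + g) * q 5 * xi q)"
    unfolding xi_def eta_def sway_def
    by (rule has_total_derivative_eq_rhs, (rule c total_derivative_intros | simp)+)
      (simp add: vec_of_def, use sc in algebra)
  show "has_total_derivative 10 ext_vessel t q \<nu> sway
    (- b * sway q + h0 g b (jet 5 s q) * xi q + g * q 5 ^ 2 * eta q)"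
    unfolding sway_def
    by (rule has_total_derivative_eq_rhs, (rule c x total_derivative_intros | simp)+)
      (simp add: vec_of_def h0_def jet_def, algebra)
qed

text \<open>The fifth derivative of r is not a function of the state; padding with 0 is harmless by
  \<open>F_cong\<close>.\<close>

definition flat_state :: "vec \<Rightarrow> vec" where
  "flat_state q = (let \<rho> = jet 5 0 q in vec_of
     [q 2, q 5, q 6, q 7, q 8, q 9, F0 g b \<rho> (eta q) (sway q), F1 g b \<rho> (eta q) (sway q),
      F2 g b \<rho> (xi q) (eta q) (sway q), F3 g b \<rho> (xi q) (eta q) (sway q) (q 3)])"

text \<open>The drift does reach the fifth derivative of r, so here the input completes the
  jet.\<close>

definition flat_input :: "vec \<Rightarrow> vec \<Rightarrow> vec" where
  "flat_input q \<nu> = (let \<rho> = jet 5 (\<nu> 0) q in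
     vec_of [\<nu> 0, delta g b \<rho> * \<nu> 1 + F4_drift g b \<rho> (xi q) (eta q) (sway q) (q 3)])"

definition brunovsky_6_4 :: system where
  "brunovsky_6_4 t z w = vec_of [z 1, z 2, z 3, z 4, z 5, w 0, z 7, z 8, z 9, w 1]"

lemma brunovsky_form_6_4: "brunovsky_form 10 2 [6, 4] brunovsky_6_4"
  by (simp add: brunovsky_form_def brunovsky_6_4_def All_less_numeral All_less_Suc vec_of_def
        Suc_numerals)

lemma flat_state_total_derivative:
  assumes "i < 10"
  shows "has_total_derivative 10 ext_vessel t q \<nu> (\<lambda>q. flat_state q i)
    (brunovsky_6_4 t (flat_state q) (flat_input q \<nu>) i)"
proof -
  let ?\<rho> = "jet 5 (\<nu> 0) q"
  note c = ext_vessel_coordinate[of _ t q \<nu>]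
  \<comment> \<open>At \<open>i = 4\<close> the derivative is the input \<open>\<nu> 0\<close>, the
    padding of the target jet.\<close>
  have j: "has_total_derivative 10 ext_vessel t q \<nu> (\<lambda>q. jet 5 0 q i) (?\<rho> (Suc i))" if "i < 5" for i
  proof -
    have "has_total_derivative 10 ext_vessel t q \<nu> (\<lambda>q. q (5 + i)) (?\<rho> (Suc i))"
      by (rule has_total_derivative_eq_rhs[OF c])
        (use that in \<open>auto simp: jet_def vec_of_def less_Suc_eq less_pred_numeral\<close>)
    with that show ?thesis by (simp add: jet_def)
  qed
  have r: "jet 5 0 q 0 = q 5" by (simp add: jet_def)
  have v: "has_total_derivative 10 ext_vessel t q \<nu> (\<lambda>q. q 3) (\<nu> 1)"
    by (rule has_total_derivative_eq_rhs[OF c]) (auto simp: vec_of_def)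
  have \<rho>: "?\<rho> i = jet 5 0 q i" if "i < 5" for i using that by (simp add: jet_def)
  note xi = frame_total_derivative(1,2)[of t q \<nu>, folded r]
    frame_total_derivative(3)[of t q \<nu> 0, folded r]
  note F = F_total_derivative[where g = g and b = b and \<rho> = "jet 5 0" and \<rho>' = "?\<rho>" and v = "\<lambda>q. q 3"
      and x = q, OF j \<rho> xi v, simplified]
  \<comment> \<open>At the fixed point \<open>q\<close> the padding 0 may be exchanged for
    \<open>\<nu> 0\<close>; the differentiated function keeps 0.\<close>
  have flat_state: "flat_state q = vec_of
     [q 2, q 5, q 6, q 7, q 8, q 9, F0 g b ?\<rho> (eta q) (sway q), F1 g b ?\<rho> (eta q) (sway q),
      F2 g b ?\<rho> (xi q) (eta q) (sway q), F3 g b ?\<rho> (xi q) (eta q) (sway q) (q 3)]"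
    using F_cong[OF \<rho>] by (simp add: flat_state_def Let_def)
  have "\<forall>i<10. has_total_derivative 10 ext_vessel t q \<nu> (\<lambda>q. flat_state q i)
    (brunovsky_6_4 t (flat_state q) (flat_input q \<nu>) i)"
    unfolding flat_state unfolding flat_state_def flat_input_def Let_def brunovsky_6_4_def
    using c[of 2] c[of 5] c[of 6] c[of 7] c[of 8] c[of 9] F
    by (simp add: All_less_numeral All_less_Suc vec_of_def
        Suc_numerals)
  with assms show ?thesis by blast
qed

section \<open>The linearizing diffeomorphism and its inverse\<close>

definition flat_map :: "vec \<Rightarrow> vec" where
  "flat_map p = (let x = state_of 10 p; u = input_of 10 2 p in
     pt 10 2 (time_of p) (flat_state x) (flat_input x u))"

text \<open>Triangular solution: Cramer's rule on \<open>q 7\<close>, \<open>q 8\<close> gives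
  \<eta> and w; then \<open>q 9\<close>, \<open>q 10\<close>, \<open>q 12\<close> give \<xi>, the
  surge speed and its derivative, each after division by delta. Rotating back by the heading
  \<open>q 1\<close> gives x and y.\<close>

definition flat_inverse :: "vec \<Rightarrow> vec" where
  "flat_inverse q = (let \<rho> = jet 2 (q 11) q; d = delta g b \<rho>;
     \<eta> = (k1 g b \<rho> * q 7 - k0 g \<rho> * q 8) / d;
     w = (h0 g b \<rho> * q 8 - h1 g b \<rho> * q 7) / d;
     \<xi> = (q 9 - h2 g b \<rho> * \<eta> - k2 g b \<rho> * w) / d;
     u = (q 10 - x3 g b \<rho> * \<xi> - h3 g b \<rho> * \<eta> - k3 g b \<rho> * w) / d in
     vec_of [q 0, \<xi> * cos (q 1) - \<eta> * sin (q 1), \<xi> * sin (q 1) + \<eta> * cos (q 1), q 1, u,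
       w - g * q 2 * \<xi>, q 2, q 3, q 4, q 5, q 6, q 11, (q 12 - F4_drift g b \<rho> \<xi> \<eta> w u) / d])"

text \<open>One condition for domain and image: only the start of the jet differs, 6 or 2, while
  index 11 is the fifth derivative of r in both.\<close>

definition regular_at :: "nat \<Rightarrow> vec set" where
  "regular_at d = {p \<in> topspace (Euclidean_space 13). delta g b (jet d (p 11) p) \<noteq> 0}"

lemma openin_regular_at: "openin (Euclidean_space 13) (regular_at d)"
proof -
  have "smooth_fun_on 13 (topspace (Euclidean_space 13)) (\<lambda>p. delta g b (jet d (p 11) p))"
  proof (rule smooth_coeffs)
    show "smooth_fun_on 13 (topspace (Euclidean_space 13)) (\<lambda>p. jet d (p 11) p i)" for i
      by (cases "i < 5") (simp_all add: jet_def smooth_intros)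
  qed auto
  from openin_Euclidean_nonzero[OF smooth_fun_on_imp_continuous_on[OF openin_topspace this]]
  show ?thesis by (simp add: regular_at_def)
qed

text \<open>The primed versions take a point of \<open>(t, x, u)\<close>-space, where state indices are shifted by
  one.\<close>

definition xi' :: "vec \<Rightarrow> real" where "xi' p = p 1 * cos (p 3) + p 2 * sin (p 3)"
definition eta' :: "vec \<Rightarrow> real" where "eta' p = p 2 * cos (p 3) - p 1 * sin (p 3)"
definition sway' :: "vec \<Rightarrow> real" where "sway' p = p 5 + g * p 6 * xi' p"

text \<open>By \<open>F_cong\<close> the two paddings merge, so that all components refer to a
  single jet, as in \<open>flat_inverse\<close>.\<close>

lemma flat_map_eq:
  "flat_map p = (let \<rho> = jet 6 (p 11) p in vec_of
     [p 0, p 3, p 6, p 7, p 8, p 9, p 10, F0 g b \<rho> (eta' p) (sway' p), F1 g b \<rho> (eta' p) (sway' p),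
      F2 g b \<rho> (xi' p) (eta' p) (sway' p), F3 g b \<rho> (xi' p) (eta' p) (sway' p) (p 4), p 11,
      delta g b \<rho> * p 12 + F4_drift g b \<rho> (xi' p) (eta' p) (sway' p) (p 4)])"
proof -
  have x: "xi (state_of 10 p) = xi' p" "eta (state_of 10 p) = eta' p" "sway (state_of 10 p) = sway' p"
    by (simp_all add: xi_def eta_def sway_def xi'_def eta'_def sway'_def state_of_def slice_def
        Suc_numerals)
  have j0: "\<And>i. i < 5 \<Longrightarrow> jet 5 0 (state_of 10 p) i = jet 6 (p 11) p i"
    and j1: "jet 5 (input_of 10 2 p 0) (state_of 10 p) = jet 6 (p 11) p"
    by (auto simp: jet_def state_of_def input_of_def slice_def fun_eq_iff)
  have F: "F0 g b (jet 5 0 (state_of 10 p)) = F0 g b (jet 6 (p 11) p)"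
    "F1 g b (jet 5 0 (state_of 10 p)) = F1 g b (jet 6 (p 11) p)"
    "F2 g b (jet 5 0 (state_of 10 p)) = F2 g b (jet 6 (p 11) p)"
    "F3 g b (jet 5 0 (state_of 10 p)) = F3 g b (jet 6 (p 11) p)"
    by (rule F_cong; erule j0)+
  show ?thesis
    unfolding flat_map_def flat_state_def flat_input_def Let_def x F j1
    by (rule vec_eqI[of _ 13])
      (simp_all add: vec_of_topspace pt_def topspace_Euclidean_space join_def vec_of_def time_of_def
        state_of_def input_of_def slice_def All_less_numeral All_less_Suc
        Suc_numerals)
qed

lemma flat_inverse_flat_map:
  assumes "p \<in> regular_at 6"
  shows "flat_inverse (flat_map p) = p"
proof -
  define \<rho> where "\<rho> = jet 6 (p 11) p"
  have d: "delta g b \<rho> \<noteq> 0" using assms by (simp add: regular_at_def \<rho>_def)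
  have \<rho>: "jet 2 (flat_map p 11) (flat_map p) = \<rho>"
    by (auto simp: flat_map_eq Let_def \<rho>_def jet_def vec_of_def fun_eq_iff
        less_Suc_eq less_pred_numeral
       Suc_numerals)
  \<comment> \<open>Cramer's rule, with \<open>delta_eq\<close> identifying the determinant.\<close>
  have \<eta>: "(k1 g b \<rho> * flat_map p 7 - k0 g \<rho> * flat_map p 8) / delta g b \<rho> = eta' p"
    using d by (simp add: flat_map_eq Let_def vec_of_def F0_def F1_def \<rho>_def[symmetric] divide_eq_eq)
      (simp add: delta_eq algebra_simps)
  have w: "(h0 g b \<rho> * flat_map p 8 - h1 g b \<rho> * flat_map p 7) / delta g b \<rho> = sway' p"
    using d by (simp add: flat_map_eq Let_def vec_of_def F0_def F1_def \<rho>_def[symmetric] divide_eq_eq)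
      (simp add: delta_eq algebra_simps)
  have \<xi>: "(flat_map p 9 - h2 g b \<rho> * eta' p - k2 g b \<rho> * sway' p) / delta g b \<rho> = xi' p"
    using d by (simp add: flat_map_eq Let_def vec_of_def F2_def \<rho>_def[symmetric])
  have u: "(flat_map p 10 - x3 g b \<rho> * xi' p - h3 g b \<rho> * eta' p - k3 g b \<rho> * sway' p)
      / delta g b \<rho> = p 4"
    using d by (simp add: flat_map_eq Let_def vec_of_def F3_def \<rho>_def[symmetric])
  have \<nu>: "(flat_map p 12 - F4_drift g b \<rho> (xi' p) (eta' p) (sway' p) (p 4)) / delta g b \<rho> = p 12"
    using d by (simp add: flat_map_eq Let_def vec_of_def \<rho>_def[symmetric])
  have sc: "sin (p 3) * sin (p 3) = 1 - cos (p 3) * cos (p 3)"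
    using sin_cos_squared_add[of "p 3"] by (simp add: power2_eq_square)
  have x: "xi' p * cos (p 3) - eta' p * sin (p 3) = p 1" "xi' p * sin (p 3) + eta' p * cos (p 3) = p 2"
    unfolding xi'_def eta'_def using sc by algebra+
  have c: "flat_map p 0 = p 0" "flat_map p 1 = p 3" "flat_map p 2 = p 6" "flat_map p 3 = p 7"
    "flat_map p 4 = p 8" "flat_map p 5 = p 9"
    "flat_map p 6 = p 10" "flat_map p 11 = p 11"
    by (simp_all add: flat_map_eq Let_def vec_of_def)
  \<comment> \<open>Rewriting follows the triangular order: a quotient takes its recorded form only
    once the earlier unknowns are replaced.\<close>
  have "flat_inverse (flat_map p) =
      vec_of [p 0, p 1, p 2, p 3, p 4, p 5, p 6, p 7, p 8, p 9, p 10, p 11, p 12]"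
    unfolding flat_inverse_def Let_def \<rho> unfolding \<eta> w unfolding \<xi> unfolding u unfolding \<nu> c x
    by (simp add: sway'_def)
  also have "\<dots> = p"
    using assms by (intro vec_eqI[of _ 13]) (simp_all add: vec_of_topspace regular_at_def,
        simp add: vec_of_def All_less_numeral All_less_Suc
        Suc_numerals)
  finally show ?thesis .
qed

lemma flat_map_flat_inverse:
  assumes "q \<in> regular_at 2"
  shows "flat_map (flat_inverse q) = q"
proof -
  define \<rho> where "\<rho> = jet 2 (q 11) q"
  define d where "d = delta g b \<rho>"
  define \<eta> where "\<eta> = (k1 g b \<rho> * q 7 - k0 g \<rho> * q 8) / d"
  define w where "w = (h0 g b \<rho> * q 8 - h1 g b \<rho> * q 7) / d"
  define \<xi> where "\<xi> = (q 9 - h2 g b \<rho> * \<eta> - k2 g b \<rho> * w) / d"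
  define u where "u = (q 10 - x3 g b \<rho> * \<xi> - h3 g b \<rho> * \<eta> - k3 g b \<rho> * w) / d"
  have d: "d \<noteq> 0" using assms by (simp add: regular_at_def \<rho>_def d_def)
  have flat_inverse: "flat_inverse q = vec_of
      [q 0, \<xi> * cos (q 1) - \<eta> * sin (q 1), \<xi> * sin (q 1) + \<eta> * cos (q 1), q 1, u,
       w - g * q 2 * \<xi>, q 2, q 3, q 4, q 5, q 6, q 11, (q 12 - F4_drift g b \<rho> \<xi> \<eta> w u) / d]"
    unfolding flat_inverse_def Let_def \<rho>_def d_def \<eta>_def w_def \<xi>_def u_def ..
  have c: "flat_inverse q 0 = q 0" "flat_inverse q 3 = q 1" "flat_inverse q 4 = u" "flat_inverse q 6 = q 2"
    "flat_inverse q 7 = q 3" "flat_inverse q 8 = q 4"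
    "flat_inverse q 9 = q 5" "flat_inverse q 10 = q 6" "flat_inverse q 11 = q 11"
    "flat_inverse q 12 = (q 12 - F4_drift g b \<rho> \<xi> \<eta> w u) / d"
    by (simp_all add: flat_inverse vec_of_def)
  have \<rho>: "jet 6 (q 11) (flat_inverse q) = \<rho>"
    by (auto simp: flat_inverse \<rho>_def jet_def vec_of_def fun_eq_iff
        less_Suc_eq less_pred_numeral
       Suc_numerals)
  have sc: "sin (q 1) * sin (q 1) = 1 - cos (q 1) * cos (q 1)"
    using sin_cos_squared_add[of "q 1"] by (simp add: power2_eq_square)
  have x: "xi' (flat_inverse q) = \<xi>" "eta' (flat_inverse q) = \<eta>"
    unfolding xi'_def eta'_def c
    by (simp_all add: flat_inverse vec_of_def) (use sc[unfolded One_nat_def] in algebra)+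
  have o: "sway' (flat_inverse q) = w"
    unfolding sway'_def x by (simp add: flat_inverse vec_of_def)
  have F: "F0 g b \<rho> \<eta> w = q 7" "F1 g b \<rho> \<eta> w = q 8"
  proof -
    \<comment> \<open>Clearing denominators turns the claims into polynomial identities;
      \<open>d\<close> is cancelled afterwards.\<close>
    have "d * \<eta> = k1 g b \<rho> * q 7 - k0 g \<rho> * q 8" "d * w = h0 g b \<rho> * q 8 - h1 g b \<rho> * q 7"
      using d by (simp_all add: \<eta>_def w_def)
    then have "d * F0 g b \<rho> \<eta> w = d * q 7" "d * F1 g b \<rho> \<eta> w = d * q 8"
      unfolding F0_def F1_def d_def delta_eq by algebra+
    with d show "F0 g b \<rho> \<eta> w = q 7" "F1 g b \<rho> \<eta> w = q 8" by simp_all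
  qed
  have F2: "F2 g b \<rho> \<xi> \<eta> w = q 9" "F3 g b \<rho> \<xi> \<eta> w u = q 10"
    using d by (simp_all add: F2_def F3_def \<xi>_def u_def d_def[symmetric])
  have "flat_map (flat_inverse q) =
      vec_of [q 0, q 1, q 2, q 3, q 4, q 5, q 6, q 7, q 8, q 9, q 10, q 11, q 12]"
    unfolding flat_map_eq Let_def c x o \<rho> F F2 using d by (simp add: d_def[symmetric])
  also have "\<dots> = q"
    using assms by (intro vec_eqI[of _ 13]) (simp_all add: vec_of_topspace regular_at_def,
        simp add: vec_of_def All_less_numeral All_less_Suc
        Suc_numerals)
  finally show ?thesis .
qed

text \<open>Both maps carry the jet over unchanged, hence preserve regularity, and the inverse gives
  surjectivity. The image is thus an explicit open set.\<close>

lemma flat_map_image: "flat_map ` regular_at 6 = regular_at 2"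
proof -
  have "flat_map p \<in> regular_at 2" if "p \<in> regular_at 6" for p
  proof -
    have "jet 2 (flat_map p 11) (flat_map p) = jet 6 (p 11) p"
      by (auto simp: flat_map_eq Let_def jet_def vec_of_def fun_eq_iff
        less_Suc_eq less_pred_numeral
       Suc_numerals)
    then show ?thesis
      using that by (simp add: regular_at_def) (simp add: flat_map_eq Let_def vec_of_topspace)
  qed
  moreover have "flat_inverse q \<in> regular_at 6" if "q \<in> regular_at 2" for q
  proof -
    have "jet 6 (flat_inverse q 11) (flat_inverse q) = jet 2 (q 11) q"
      by (auto simp: flat_inverse_def Let_def jet_def vec_of_def fun_eq_iff
        less_Suc_eq less_pred_numeral
       Suc_numerals)
    then show ?thesis
      using that by (simp add: regular_at_def) (simp add: flat_inverse_def Let_def vec_of_topspace)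
  qed
  ultimately show ?thesis
    using flat_map_flat_inverse by (auto simp: image_iff) metis
qed

lemma regular_at_nonempty:
  assumes "g \<noteq> 0" "b > 0"
  shows "regular_at 6 \<noteq> {}"
proof -
  \<comment> \<open>The point with r = 1 and all else 0, where delta is -g ((1 + g)^2 + b^2); b > 0
    keeps the second factor positive even at g = -1.\<close>
  let ?p = "vec_of [0, 0, 0, 0, 0, 0, 1, 0, 0, 0, 0, 0, 0]"
  have "(1 + g)\<^sup>2 + b\<^sup>2 > 0" using assms by (simp add: add_nonneg_pos)
  then have "delta g b (jet 6 (?p 11) ?p) \<noteq> 0"
    using assms by (simp add: delta_def jet_def vec_of_def)
  then show ?thesis
    by (auto simp: regular_at_def vec_of_topspace intro!: exI[of _ ?p])
qed

section \<open>Smoothness and the static feedback transformation\<close>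

lemma smooth_flat_map: "smooth_map_on 13 13 (regular_at 6) flat_map"
proof -
  have r: "smooth_fun_on 13 (regular_at 6) (\<lambda>p. jet 6 (p 11) p i)" for i
    by (cases "i < 5") (simp_all add: jet_def smooth_intros[OF openin_regular_at])
  have r0: "smooth_fun_on 13 (regular_at 6) (\<lambda>p. jet 6 (p 11) p 0)" by (rule r)
  show ?thesis
  proof (unfold smooth_map_on_def, intro conjI)
    show "flat_map ` regular_at 6 \<subseteq> topspace (Euclidean_space 13)"
      by (auto simp: flat_map_eq Let_def vec_of_topspace)
    show "\<forall>i<13. smooth_fun_on 13 (regular_at 6) (\<lambda>p. flat_map p i)"
      by (simp add: flat_map_eq Let_def vec_of_def All_less_numeral All_less_Suc,
        unfold F0_def F1_def F2_def F3_def F4_drift_def sway'_def xi'_def eta'_def)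
        (intro conjI; (rule smooth_coeffs[OF openin_regular_at r] r0
          smooth_intros[OF openin_regular_at])+)
  qed
qed

lemma smooth_flat_inverse: "smooth_map_on 13 13 (regular_at 2) flat_inverse"
proof -
  have r: "smooth_fun_on 13 (regular_at 2) (\<lambda>p. jet 2 (p 11) p i)" for i
    by (cases "i < 5") (simp_all add: jet_def smooth_intros[OF openin_regular_at])
  have r0: "smooth_fun_on 13 (regular_at 2) (\<lambda>p. jet 2 (p 11) p 0)" by (rule r)
  have nz: "delta g b (jet 2 (p 11) p) \<noteq> 0" if "p \<in> regular_at 2" for p
    using that by (simp add: regular_at_def)
  \<comment> \<open>Every denominator in \<open>flat_inverse\<close> is delta of the same
    jet.\<close>
  note div = smooth_fun_on_divide[OF openin_regular_at _ smooth_coeffs(9)[OF openin_regular_at r] nz]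
  show ?thesis
  proof (unfold smooth_map_on_def, intro conjI)
    show "flat_inverse ` regular_at 2 \<subseteq> topspace (Euclidean_space 13)"
      by (auto simp: flat_inverse_def Let_def vec_of_topspace)
    show "\<forall>i<13. smooth_fun_on 13 (regular_at 2) (\<lambda>p. flat_inverse p i)"
      by (simp add: flat_inverse_def Let_def vec_of_def All_less_numeral All_less_Suc, unfold F4_drift_def)
        (intro conjI; (rule smooth_coeffs[OF openin_regular_at r] r0 div
          smooth_intros[OF openin_regular_at] | assumption)+)
  qed
qed

lemma static_feedback_transformation_ext_vessel:
  "static_feedback_transformation 10 2 (regular_at 6) ext_vessel brunovsky_6_4
     (\<lambda>_. flat_state) (\<lambda>_. flat_input)"
proof -
  have "diffeomorphism_on 13 (regular_at 6) flat_map"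
    unfolding diffeomorphism_on_def flat_map_image
    using openin_regular_at smooth_flat_map smooth_flat_inverse flat_inverse_flat_map by blast
  \<comment> \<open>Slicing is harmless: the right-hand side reads only states below 10 and inputs
    below 2.\<close>
  moreover have "brunovsky_6_4 t (slice 0 10 (flat_state q)) (slice 0 2 (flat_input q \<nu>)) =
      brunovsky_6_4 t (flat_state q) (flat_input q \<nu>)"
    for t q \<nu>
    by (simp add: brunovsky_6_4_def slice_def Suc_numerals)
  ultimately show ?thesis
    unfolding static_feedback_transformation_def Let_def
    by (simp add: flat_map_def[abs_def] Let_def has_total_derivative_imp[OF flat_state_total_derivative])
qed

lemma control_system_ext_vessel:
  "control_system 10 2 (topspace (Euclidean_space 13)) ext_vessel"
proof -
  have ne: "topspace (Euclidean_space 13) \<noteq> {}"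
    by (auto simp: topspace_Euclidean_space intro: exI[of _ "\<lambda>_. 0"])
  have "\<forall>i<10. smooth_fun_on 13 (topspace (Euclidean_space 13))
     (\<lambda>p. ext_vessel (time_of p) (state_of 10 p) (input_of 10 2 p) i)"
    by (simp add: ext_vessel_nth,
        simp add: vec_of_def All_less_numeral All_less_Suc state_of_def input_of_def slice_def)
      (intro conjI; (rule smooth_intros[OF openin_topspace])+)
  with ne show ?thesis by (simp add: control_system_def)
qed

lemma control_system_vessel:
  "control_system 6 2 (topspace (Euclidean_space (1 + 6 + 2))) (vessel g g2 b1 b b3)"
proof -
  have ne: "topspace (Euclidean_space 9) \<noteq> {}"
    by (auto simp: topspace_Euclidean_space intro: exI[of _ "\<lambda>_. 0"])
  have "\<forall>i<6. smooth_fun_on 9 (topspace (Euclidean_space 9))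
     (\<lambda>p. vessel g g2 b1 b b3 (time_of p) (state_of 6 p) (input_of 6 2 p) i)"
    \<comment> \<open>Division by \<open>g\<close> becomes multiplication by a constant, which is
      smooth without a side condition.\<close>
    by (simp add: vessel_def Let_def All_less_numeral All_less_Suc state_of_def input_of_def slice_def,
        unfold divide_inverse)
      (intro conjI; (rule smooth_intros[OF openin_topspace])+)
  with ne show ?thesis by (simp add: control_system_def)
qed

lemma linearizes_ext_vessel:
  assumes "g \<noteq> 0" "b > 0"
  shows "linearizes_to 10 2 (topspace (Euclidean_space 13)) ext_vessel [6, 4]"
  unfolding linearizes_to_def
  using control_system_ext_vessel static_feedback_transformation_ext_vessel brunovsky_form_6_4
    regular_at_nonempty[OF assms] openin_subset[OF openin_regular_at]
  by blast

end

section \<open>The dynamic extension as a submersion\<close>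

lemma DERIV_coordinate:
  "((\<lambda>s. (p(j := s)) i) has_real_derivative (if j = i then 1 else 0)) (at (p j))"
  by (cases "j = i") auto

lemma pderivative_coordinate: "pderivative j (\<lambda>p. p i) p = (if j = i then 1 else 0)"
  unfolding pderivative_def by (rule DERIV_imp_deriv[OF DERIV_coordinate])

text \<open>The common shape of both feedback components: a new variable entering with coefficient
  1, plus a quadratic and a linear term in the vessel state.\<close>

lemma pderivative_quadratic:
  "pderivative j (\<lambda>q. q i - c * (q k * q l) + d * q m) p =
     (if j = i then 1 else 0) - c * ((if j = k then p l else 0) + (if j = l then p k else 0))
     + d * (if j = m then 1 else 0)"
proof -
  note D = DERIV_coordinate[of p j]
  show ?thesis
    unfolding pderivative_def
    by (rule DERIV_imp_deriv[OF DERIV_cong[OF DERIV_add[OF DERIV_diff[OF D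
        DERIV_cmult[OF DERIV_mult[OF D D]]] DERIV_cmult[OF D]]]]) simp
qed

lemma dynamic_extension_vessel:
  "dynamic_extension 6 2 (topspace (Euclidean_space (1 + 6 + 2))) (vessel g g2 b1 b b3) 4
     (topspace (Euclidean_space 13)) ext_dynamics (ext_feedback g g2 b1 b3)"
proof -
  let ?V = "topspace (Euclidean_space 13)"
  \<comment> \<open>Naming \<open>1 / g\<close> keeps the surge component in the shape of
    \<open>pderivative_quadratic\<close>.\<close>
  define c where "c = 1 / g"
  define G where "G p = vec_of [p 0, p 1, p 2, p 3, p 4, p 5, p 6,
    p 12 - c * (p 5 * p 6) + b1 * p 4, p 7 - g2 * (p 4 * p 5) + b3 * p 6]" for p :: vec
  have ne: "?V \<noteq> {}" by (auto simp: topspace_Euclidean_space intro: exI[of _ "\<lambda>_. 0"])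
  have G: "pt 6 2 (time_of p) (slice 0 6 (state_of 10 p))
      (ext_feedback g g2 b1 b3 (time_of p) (slice 0 6 (state_of 10 p)) (slice 6 4 (state_of 10 p))
        (input_of 10 2 p)) = G p" for p
    by (rule vec_eqI[of _ 9])
      (simp_all add: vec_of_topspace G_def c_def pt_def topspace_Euclidean_space join_def vec_of_def
        ext_feedback_def time_of_def state_of_def input_of_def slice_def All_less_numeral All_less_Suc
        Suc_numerals)
  have a: "\<forall>i<4. smooth_fun_on 13 ?V (\<lambda>p. ext_dynamics (time_of p) (slice 0 6 (state_of 10 p))
     (slice 6 4 (state_of 10 p)) (input_of 10 2 p) i)"
    by (simp add: ext_dynamics_def vec_of_def state_of_def input_of_def slice_def All_less_numeral
        All_less_Suc smooth_fun_on_coordinate[OF openin_topspace])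
  have smooth: "smooth_map_on 13 9 ?V G"
  proof (unfold smooth_map_on_def, intro conjI)
    show "G ` ?V \<subseteq> topspace (Euclidean_space 9)"
      by (auto simp: G_def vec_of_topspace)
    show "\<forall>i<9. smooth_fun_on 13 ?V (\<lambda>p. G p i)"
      by (simp add: G_def vec_of_def All_less_numeral All_less_Suc)
        (intro conjI; (rule smooth_intros[OF openin_topspace])+)
  qed
  have sub: "\<exists>h\<in>?V. \<forall>i<9. (\<Sum>j<13. pderivative j (\<lambda>q. G q i) p * h j) = w i" for p w
  proof -
    \<comment> \<open>Entries 0 to 6 are forced by time and vessel state. Of the last two rows,
      \<open>p 12\<close> occurs only in row 7 and \<open>p 7\<close> only in row 8, each with
      coefficient 1, so each row is solved for its own entry.\<close>
    define h where "h = vec_of [w 0, w 1, w 2, w 3, w 4, w 5, w 6,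
      w 8 + g2 * (p 4 * w 5 + p 5 * w 4) - b3 * w 6, 0, 0, 0, 0,
      w 7 + c * (p 5 * w 6 + p 6 * w 5) - b1 * w 4]"
    have "\<forall>i<9. (\<Sum>j<13. pderivative j (\<lambda>q. G q i) p * h j) = w i"
      by (simp add: G_def h_def vec_of_def All_less_numeral All_less_Suc pderivative_coordinate
          pderivative_quadratic lessThan_nat_numeral lessThan_Suc
          Suc_numerals)
        (simp add: algebra_simps)
    moreover have "h \<in> ?V" by (simp add: h_def vec_of_topspace)
    ultimately show ?thesis by blast
  qed
  show ?thesis
    using ne a smooth sub
    by (auto simp: dynamic_extension_def Let_def G submersion_on_def smooth_map_on_def)
qed

theorem theorem1:
  fixes \<gamma>1 \<gamma>2 \<beta>1 \<beta>2 \<beta>3 :: real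
  assumes "\<gamma>1 \<noteq> 0" and "\<beta>1 > 0" and "\<beta>2 > 0" and "\<beta>3 > 0" and "\<gamma>2 \<noteq> 0"
  defines "f \<equiv> vessel \<gamma>1 \<gamma>2 \<beta>1 \<beta>2 \<beta>3"
    and "D \<equiv> topspace (Euclidean_space (1 + 6 + 2))"
  shows "dynamic_feedback_linearizable 6 2 D f \<and>
    (\<exists>k V a b. dynamic_extension 6 2 D f k V a b \<and>
       linearizable_of_order (6 + k) 2 V (extended_system 6 2 f k a b) 6)"
proof -
  let ?V = "topspace (Euclidean_space 13)" and ?b = "ext_feedback \<gamma>1 \<gamma>2 \<beta>1 \<beta>3"
  have ext: "dynamic_extension 6 2 D f 4 ?V ext_dynamics ?b"
    unfolding D_def f_def by (rule dynamic_extension_vessel)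
  \<comment> \<open>The count 6 + 4 arises twice: vessel and extension states on one side, the
    chains of the heading and of F on the other.\<close>
  have lin: "linearizes_to (6 + 4) 2 ?V (extended_system 6 2 f 4 ext_dynamics ?b) [6, 4]"
    using linearizes_ext_vessel[OF assms(1,3)] by (simp add: ext_vessel_def f_def)
  have "control_system 6 2 D f"
    unfolding D_def f_def by (rule control_system_vessel)
  then have "dynamic_feedback_linearizable 6 2 D f"
    unfolding dynamic_feedback_linearizable_def static_feedback_linearizable_def
    using ext lin by blast
  moreover have "linearizable_of_order (6 + 4) 2 ?V (extended_system 6 2 f 4 ext_dynamics ?b) 6"
    unfolding linearizable_of_order_def using lin by (intro exI[of _ "[6, 4]"]) simp
  ultimately show ?thesis
    using ext by blast
qed

end
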